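(* Let $d\ge2$. For every $\Lambda\in\mathcal{WR}_d$, $\mu(\Lambda)\le q^{-d}$.
   Context: Let $q$ be a prime power, $\mathcal R=\mathbb F_q[x]$, and $\tilde{\mathcal K}=\mathbb F_q((x^{-1}))$, with the absolute value $|\cdot|$ extending $|f|=q^{\deg f}$ for nonzero $f\in\mathcal R$ (and $|0|=0$). On $\tilde{\mathcal K}^d$ use the norm $\|\mathbf v\|=\max_i|v_i|$. $\mathcal L_d$ is the space of unimodular lattices in $\tilde{\mathcal K}^d$, i.e. sets $g\mathcal R^d$ with $g$ an invertible $d\times d$ matrix over $\tilde{\mathcal K}$ with $|\det(g)|=1$. Let $\ell(\Lambda)=\min\{\|\mathbf v\|:\mathbf v\in\Lambda\setminus\{0\}\}$. A lattice $\Lambda\in\mathcal L_d$ is well rounded if it contains $d$ linearly independent vectors of norm $\ell(\Lambda)$; $\mathcal{WR}_d$ is the set of well rounded lattices in $\mathcal L_d$. Let $N(\mathbf v)=\prod_{i=1}^d|v_i|$; the Minkowski function is $\mu(\Lambda)=\sup_{\mathbf v\in\tilde{\mathcal K}^d}\inf_{\mathbf u\in\Lambda}N(\mathbf v-\mathbf u)$. *)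

theory Defs
  imports "HOL-Analysis.Analysis" "HOL-Computational_Algebra.Computational_Algebra"
begin

text \<open>
  \<open>'a\<close> is the finite field with \<open>q = CARD('a)\<close> elements.  The field \<open>'a fls\<close> of formal Laurent
  series in \<open>fls_X\<close> models the field of Laurent series in \<open>x\<^sup>-\<^sup>1\<close>: the library variable \<open>fls_X\<close>
  plays the role of \<open>x\<^sup>-\<^sup>1\<close>, so that \<open>x\<close> itself is \<open>fls_X_inv\<close>.  The library's metric on \<open>fls\<close>
  has base 2 rather than \<open>q\<close>, so the absolute value is defined separately.
\<close>

definition fls_abs :: "('a :: {field, finite}) fls \<Rightarrow> real" where
  "fls_abs f = (if f = 0 then 0 else real CARD('a) powi (- fls_subdegree f))"

definition poly_to_fls :: "('a :: {field, finite}) poly \<Rightarrow> 'a fls" where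
  "poly_to_fls p = poly (map_poly fls_const p) fls_X_inv"

lemma poly_to_fls_nth: "fls_nth (poly_to_fls p) k = (if k \<le> 0 then coeff p (nat (- k)) else 0)"
proof -
  have "degree (map_poly fls_const p) = degree p"
    by (rule degree_map_poly) simp
  then have "fls_nth (poly_to_fls p) k =
      (\<Sum>i\<le>degree p. if k = - int i then coeff p i else 0)"
    by (auto simp: poly_to_fls_def poly_altdef coeff_map_poly fls_nth_sum intro!: sum.cong)
  also have "\<dots> = (if k \<le> 0 then coeff p (nat (- k)) else 0)"
  proof (cases "k \<le> 0")
    case True
    then have "(k = - int i) = (i = nat (- k))" for i by auto
    then show ?thesis using True by (simp add: coeff_eq_0)
  next
    case False
    then show ?thesis by (auto intro!: sum.neutral)
  qed
  finally show ?thesis .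
qed

lemma fls_abs_poly_to_fls:
  fixes p :: "('a :: {field, finite}) poly"
  assumes "p \<noteq> 0"
  shows "fls_abs (poly_to_fls p) = real CARD('a) ^ degree p"
proof -
  have lc: "fls_nth (poly_to_fls p) (- int (degree p)) \<noteq> 0"
    using assms by (simp add: poly_to_fls_nth)
  then have "poly_to_fls p \<noteq> 0" by auto
  moreover have "fls_subdegree (poly_to_fls p) = - int (degree p)"
    using lc by (rule fls_subdegree_eqI) (auto simp: poly_to_fls_nth coeff_eq_0)
  ultimately show ?thesis by (simp add: fls_abs_def)
qed

definition vec_norm :: "('a :: {field, finite}) fls ^ 'n \<Rightarrow> real" where
  "vec_norm v = Max (range (\<lambda>i. fls_abs (v $ i)))"

definition poly_vecs :: "(('a :: {field, finite}) fls ^ 'n) set" where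
  "poly_vecs = {v. \<forall>i. v $ i \<in> range poly_to_fls}"

definition unimodular_lattices :: "(('a :: {field, finite}) fls ^ 'n) set set" where
  "unimodular_lattices =
     {(\<lambda>v. g *v v) ` poly_vecs | g :: 'a fls ^ 'n ^ 'n. invertible g \<and> fls_abs (det g) = 1}"

text \<open>
  The minimum is written as an infimum.  It is attained for every lattice; for well rounded
  sets, defined below, attainment is part of the definition.
\<close>

definition min_length :: "(('a :: {field, finite}) fls ^ 'n) set \<Rightarrow> real" where
  "min_length L = (INF v \<in> L - {0}. vec_norm v)"

definition well_rounded :: "(('a :: {field, finite}) fls ^ 'n) set \<Rightarrow> bool" where
  "well_rounded L \<longleftrightarrow>
     (\<exists>B \<subseteq> L. card B = CARD('n) \<and> vec.independent B \<and> (\<forall>v\<in>B. vec_norm v = min_length L))"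

definition well_rounded_lattices :: "(('a :: {field, finite}) fls ^ 'n) set set" where
  "well_rounded_lattices = {L \<in> unimodular_lattices. well_rounded L}"

definition prod_norm :: "('a :: {field, finite}) fls ^ 'n \<Rightarrow> real" where
  "prod_norm v = (\<Prod>i\<in>UNIV. fls_abs (v $ i))"

text \<open>
  Taken in the extended reals, so that the supremum is meaningful without a boundedness proof.
\<close>

definition minkowski_fun :: "(('a :: {field, finite}) fls ^ 'n) set \<Rightarrow> ereal" where
  "minkowski_fun L = (SUP v. INF u\<in>L. ereal (prod_norm (v - u)))"

end

theory Submission
  imports Defs
begin

unbundle fps_syntax

text \<open>
  Write \<open>q\<close> for the size of the field, \<open>R\<close> for the polynomial ring, \<open>L = g R\<^sup>d\<close> for the lattice,
  \<open>\<ell>\<close> for its minimum, and let \<open>M\<close> be a matrix whose columns are \<open>d\<close> linearly independent vectors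
  of \<open>L\<close> of norm \<open>\<ell>\<close>.

  Every Laurent series is within \<open>1/q\<close> of a polynomial.  Rounding the coordinates of a vector
  with respect to the columns of \<open>M\<close> therefore moves it by at most \<open>\<ell>/q\<close>, because the norm is
  ultrametric: a combination of vectors of norm \<open>\<ell>\<close> with coefficients of size at most \<open>1/q\<close> has norm
  at most \<open>\<ell>/q\<close>, however many terms it has (\<open>rounding_along_matrix\<close>).  So each \<open>v\<close> has a lattice
  point \<open>u\<close> with \<open>N(v - u) \<le> (\<ell>/q)\<^sup>d\<close>, and what remains is to show \<open>\<ell> \<le> 1\<close>.  This is the part of
  Minkowski's second theorem that is relevant here, and for well rounded lattices it has a short
  proof by two comparisons with the determinant of \<open>M\<close>.

  The upper bound is \<open>|det M| \<le> 1\<close>.  Rounding a lattice vector leaves a lattice vector of norm at most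
  \<open>\<ell>/q < \<ell>\<close>, which must vanish.  Hence the columns of \<open>M\<close> generate \<open>L\<close>
  (\<open>shortest_vectors_generate\<close>), so \<open>g = M Q\<close> with \<open>Q\<close> a polynomial matrix.  Its determinant is a
  nonzero polynomial, of absolute value at least 1, while \<open>|det g| = 1\<close>
  (\<open>det_abs_le_of_lattice_subset\<close>).

  The lower bound is \<open>\<ell>\<^sup>d \<le> |det M|\<close>.  After scaling \<open>M\<close> to have entries in the valuation ring, reduce
  it to a matrix over the finite field.  A vector of constants in the kernel of the
  reduction would combine the columns to a nonzero lattice vector shorter than \<open>\<ell>\<close>.  So the reduction
  is invertible, and the determinant of the scaled matrix is a unit of the valuation ring
  (\<open>det_abs_ge_of_shortest\<close>).
\<close>

section \<open>The absolute value\<close>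

lemma two_le_card_field: "2 \<le> real CARD('a :: {field, finite})"
proof -
  have "card {0, 1 :: 'a} \<le> CARD('a)" by (rule card_mono) auto
  then show ?thesis by simp
qed

lemma fls_abs_0 [simp]: "fls_abs 0 = 0"
  by (simp add: fls_abs_def)

lemma fls_abs_nonneg [simp]: "0 \<le> fls_abs f"
  by (simp add: fls_abs_def)

lemma fls_abs_eq_0_iff [simp]: "fls_abs (f :: 'a :: {field, finite} fls) = 0 \<longleftrightarrow> f = 0"
proof -
  have "real CARD('a) powi k \<noteq> 0" for k
    using two_le_card_field[where 'a='a] by (simp add: power_int_eq_0_iff)
  then show ?thesis by (auto simp: fls_abs_def)
qed

lemma fls_abs_mult: "fls_abs (f * g) = fls_abs f * fls_abs g"
  by (simp add: fls_abs_def power_int_diff power_int_minus field_simps)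

lemma fls_abs_1 [simp]: "fls_abs 1 = 1"
  by (simp add: fls_abs_def)

lemma fls_abs_power: "fls_abs (f ^ n) = fls_abs f ^ n"
  by (induction n) (auto simp: fls_abs_mult)

text \<open>
  In the variable \<open>x = fls_X_inv\<close> the coefficient with index \<open>j\<close> belongs to \<open>x\<close> to the power \<open>- j\<close>;
  balls are thus described by vanishing coefficients, which turns estimates into linear conditions
  over the finite field.
\<close>

lemma fls_abs_le_iff:
  fixes f :: "'a :: {field, finite} fls"
  shows "fls_abs f \<le> real CARD('a) powi k \<longleftrightarrow> (\<forall>j < - k. f $$ j = 0)"
proof (cases "f = 0")
  case False
  have q: "1 < real CARD('a)" using two_le_card_field[where 'a='a] by linarith
  have "fls_abs f \<le> real CARD('a) powi k \<longleftrightarrow> - fls_subdegree f \<le> k"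
    using False q power_int_strict_increasing[of k "- fls_subdegree f" "real CARD('a)"]
      power_int_increasing[of "- fls_subdegree f" k "real CARD('a)"]
    by (auto simp: fls_abs_def not_le[symmetric])
  also have "\<dots> \<longleftrightarrow> (\<forall>j < - k. f $$ j = 0)"
    using False fls_subdegree_geI[of f "- k"] fls_eq0_below_subdegree[of _ f]
    by (smt (verit, ccfv_threshold))
  finally show ?thesis .
qed (simp add: zero_le_power_int)

lemma fls_abs_add_le:
  fixes f g :: "'a :: {field, finite} fls"
  assumes "fls_abs f \<le> r" "fls_abs g \<le> r"
  shows "fls_abs (f + g) \<le> r"
proof (cases "f = 0 \<or> g = 0 \<or> f + g = 0")
  case True
  then show ?thesis using assms order_trans[OF fls_abs_nonneg assms(1)] by auto
next
  case False
  have q: "1 \<le> real CARD('a)" using two_le_card_field[where 'a='a] by linarith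
  have "min (fls_subdegree f) (fls_subdegree g) \<le> fls_subdegree (f + g)"
    using False by (intro fls_plus_subdegree) auto
  then have "fls_abs (f + g) \<le> fls_abs f \<or> fls_abs (f + g) \<le> fls_abs g"
    using False q by (auto simp: fls_abs_def min_def intro!: power_int_increasing split: if_splits)
  then show ?thesis using assms by linarith
qed

lemma fls_abs_sum_le:
  assumes "0 \<le> r" "\<And>x. x \<in> A \<Longrightarrow> fls_abs (f x) \<le> r"
  shows "fls_abs (sum f A) \<le> r"
  using assms by (induction A rule: infinite_finite_induct) (auto intro: fls_abs_add_le)

lemma vec_norm_le_iff: "vec_norm v \<le> r \<longleftrightarrow> (\<forall>i. fls_abs (v $ i) \<le> r)"
  by (auto simp: vec_norm_def)

lemma fls_abs_le_vec_norm: "fls_abs (v $ i) \<le> vec_norm v"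
  using vec_norm_le_iff[of v "vec_norm v"] by auto

lemma vec_norm_nonneg: "0 \<le> vec_norm v"
  using fls_abs_le_vec_norm[of v undefined] fls_abs_nonneg order_trans by blast

text \<open>
  The value group is discrete, so a lattice minimum can be scaled to 1 by a power of \<open>x\<close>.
\<close>

lemma vec_norm_eq_powi:
  fixes v :: "('a :: {field, finite}) fls ^ 'n"
  assumes "v \<noteq> 0"
  obtains k where "vec_norm v = real CARD('a) powi k"
proof -
  have "vec_norm v \<in> range (\<lambda>i. fls_abs (v $ i))"
    unfolding vec_norm_def by (rule Max_in) auto
  then obtain i where i: "vec_norm v = fls_abs (v $ i)" by auto
  have "v $ i \<noteq> 0"
  proof
    assume "v $ i = 0"
    then have "fls_abs (v $ j) = 0" for j
      using fls_abs_le_vec_norm[of v j] fls_abs_nonneg[of "v $ j"] i \<open>v $ i = 0\<close>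
      by (intro order_antisym) auto
    with assms show False by (simp add: vec_eq_iff)
  qed
  then show ?thesis using that i by (simp add: fls_abs_def)
qed

lemma vec_norm_mult_le:
  assumes "\<And>j. vec_norm (column j M) \<le> r" "vec_norm y \<le> s"
  shows "vec_norm (M *v y) \<le> r * s"
proof -
  have r: "0 \<le> r" using order_trans[OF vec_norm_nonneg assms(1)] .
  have s: "0 \<le> s" using order_trans[OF vec_norm_nonneg assms(2)] .
  have "fls_abs (M $ i $ j * y $ j) \<le> r * s" for i j
    using assms r s unfolding vec_norm_le_iff fls_abs_mult
    by (intro mult_mono) (auto simp: column_def)
  then show ?thesis
    using r s by (auto simp: vec_norm_le_iff matrix_vector_mult_def intro!: fls_abs_sum_le)
qed

lemma prod_norm_le:
  fixes v :: "('a :: {field, finite}) fls ^ 'n"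
  assumes "vec_norm v \<le> r"
  shows "prod_norm v \<le> r ^ CARD('n)"
proof -
  have "prod_norm v \<le> (\<Prod>i\<in>(UNIV :: 'n set). r)"
    unfolding prod_norm_def using assms by (intro prod_mono) (auto simp: vec_norm_le_iff)
  then show ?thesis by simp
qed

section \<open>Determinants and invertibility\<close>

text \<open>
  Serves three homomorphisms: the embeddings of polynomials and of power series into
  Laurent series, and the reduction of power series to their constant term.
\<close>

lemma det_ring_hom:
  fixes h :: "'a :: comm_ring_1 \<Rightarrow> 'b :: comm_ring_1" and A :: "'a ^ 'n ^ 'n"
  assumes add: "\<And>x y. h (x + y) = h x + h y"
    and mult: "\<And>x y. h (x * y) = h x * h y" and one: "h 1 = 1"
  shows "h (det A) = det (\<chi> i j. h (A $ i $ j))"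
proof -
  have zero: "h 0 = 0" using add[of 0 0] by simp
  have neg: "h (- x) = - h x" for x
    using add[of x "- x"] zero by (simp add: eq_neg_iff_add_eq_0 add.commute)
  have sum: "h (sum f S) = (\<Sum>x\<in>S. h (f x))" for f :: "('n \<Rightarrow> 'n) \<Rightarrow> 'a" and S
    by (induction S rule: infinite_finite_induct) (auto simp: zero add)
  have prod: "h (prod f S) = (\<Prod>x\<in>S. h (f x))" for f :: "'n \<Rightarrow> 'a" and S
    by (induction S rule: infinite_finite_induct) (auto simp: one mult)
  show ?thesis
    by (auto simp: det_def sum mult prod sign_def one neg intro!: sum.cong)
qed

text \<open>
  Extracting the coefficient of index 0 is multiplicative only on the valuation ring.  The
  matrix is therefore lifted to power series, where the constant term is a ring homomorphism.
\<close>

lemma det_fls_nth_0: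
  fixes U :: "'a :: field fls ^ 'n ^ 'n"
  assumes "\<And>i j k. k < 0 \<Longrightarrow> U $ i $ j $$ k = 0"
  shows "det U $$ 0 = det (\<chi> i j. U $ i $ j $$ 0)"
proof -
  define V where "V = (\<chi> i j. fls_regpart (U $ i $ j))"
  have U: "U = (\<chi> i j. fps_to_fls (V $ i $ j))"
    using assms by (simp add: V_def vec_eq_iff fls_subdegree_ge0I)
  have "det U = fps_to_fls (det V)"
    unfolding U by (subst det_ring_hom[of fps_to_fls]) (auto simp: fls_times_fps_to_fls)
  then have "det U $$ 0 = det V $ 0" by simp
  also have "\<dots> = det (\<chi> i j. V $ i $ j $ 0)"
    by (rule det_ring_hom) auto
  finally show ?thesis by (simp add: V_def)
qed

lemma invertible_matrix_of_independent:
  fixes B :: "('a :: field ^ 'n) set"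
  assumes "vec.independent B" "card B = CARD('n)"
  obtains M :: "'a ^ 'n ^ 'n" where "invertible M" "range (\<lambda>j. column j M) = B"
proof -
  have fin: "finite B" using assms(2) by (intro card_ge_0_finite) auto
  obtain b where b: "bij_betw b (UNIV :: 'n set) B"
    using finite_same_card_bij[of "UNIV :: 'n set" B] fin assms(2) by auto
  define M :: "'a ^ 'n ^ 'n" where "M = (\<chi> i j. b j $ i)"
  have col: "column j M = b j" for j by (simp add: M_def column_def vec_eq_iff)
  have range: "range (\<lambda>j. column j M) = B" using b by (simp add: col bij_betw_def)
  have "vec.span B = UNIV"
    using vec.card_ge_dim_independent[of B UNIV] assms by (auto simp: card_cart_basis)
  then have "invertible M"
    using range matrix_right_invertible_span_columns[of M]
    by (auto simp: invertible_right_inverse columns_def full_SetCompr_eq)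
  then show ?thesis using that range by blast
qed

section \<open>Polynomials and polynomial matrices\<close>

lemma poly_to_fls_add: "poly_to_fls (p + r) = poly_to_fls p + poly_to_fls r"
  by (rule fls_eqI) (simp add: poly_to_fls_nth)

lemma poly_to_fls_pCons: "poly_to_fls (pCons a p) = fls_const a + fls_X_inv * poly_to_fls p"
  by (cases "pCons a p = 0") (auto simp: poly_to_fls_def map_poly_pCons)

lemma poly_to_fls_smult: "poly_to_fls (smult a p) = fls_const a * poly_to_fls p"
  by (rule fls_eqI) (simp add: poly_to_fls_nth)

lemma poly_to_fls_mult: "poly_to_fls (p * r) = poly_to_fls p * poly_to_fls r"
  by (induction p)
     (simp_all add: poly_to_fls_add poly_to_fls_pCons poly_to_fls_smult algebra_simps
        poly_to_fls_def[of 0])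

lemma poly_to_fls_0 [simp]: "poly_to_fls 0 = 0"
  by (simp add: poly_to_fls_def)

lemma poly_to_fls_1 [simp]: "poly_to_fls 1 = 1"
  by (rule fls_eqI) (auto simp: poly_to_fls_nth coeff_1)

lemma fls_const_in_range: "fls_const c \<in> range poly_to_fls"
  using rangeI[of poly_to_fls "[:c:]"] by (simp add: poly_to_fls_pCons)

lemma range_poly_to_fls_mult:
  "f \<in> range poly_to_fls \<Longrightarrow> g \<in> range poly_to_fls \<Longrightarrow> f * g \<in> range poly_to_fls"
  by (auto simp flip: poly_to_fls_mult)

lemma range_poly_to_fls_sum:
  "(\<And>x. x \<in> A \<Longrightarrow> f x \<in> range poly_to_fls) \<Longrightarrow> sum f A \<in> range poly_to_fls"
proof (induction A rule: infinite_finite_induct)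
  case (insert x A)
  then obtain p r where "f x = poly_to_fls p" "sum f A = poly_to_fls r"
    by (meson imageE insertCI)
  then show ?case using insert by (auto simp flip: poly_to_fls_add)
qed (auto simp: image_iff intro!: exI[of _ 0])

text \<open>
  The polynomial collects the terms of \<open>f\<close> with nonnegative powers of \<open>x\<close>; the rest starts at
  \<open>x\<^sup>-\<^sup>1\<close>.
\<close>

lemma polynomial_part:
  fixes f :: "'a :: {field, finite} fls"
  obtains p where "fls_abs (f - poly_to_fls p) \<le> 1 / real CARD('a)"
proof -
  define n where "n = nat (- fls_subdegree f)"
  define p where "p = (\<Sum>i\<le>n. monom (f $$ (- int i)) i)"
  have coeff: "coeff p i = f $$ (- int i)" for i
    by (auto simp: p_def coeff_sum n_def intro!: fls_eq0_below_subdegree[symmetric])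
  have "(f - poly_to_fls p) $$ j = 0" if "j < 1" for j
    using that by (simp add: poly_to_fls_nth coeff)
  then have "fls_abs (f - poly_to_fls p) \<le> real CARD('a) powi (- 1)"
    unfolding fls_abs_le_iff by simp
  then show ?thesis using that by (simp add: divide_inverse)
qed

lemma poly_vecs_rounding:
  fixes y :: "('a :: {field, finite}) fls ^ 'n"
  obtains p where "p \<in> poly_vecs" "vec_norm (y - p) \<le> 1 / real CARD('a)"
proof -
  have "\<forall>i. \<exists>p. fls_abs (y $ i - poly_to_fls p) \<le> 1 / real CARD('a)"
    using polynomial_part by blast
  then obtain p where "\<And>i. fls_abs (y $ i - poly_to_fls (p i)) \<le> 1 / real CARD('a)" by metis
  then show ?thesis
    by (intro that[of "\<chi> i. poly_to_fls (p i)"]) (auto simp: poly_vecs_def vec_norm_le_iff)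
qed

lemma det_polynomial_matrix:
  fixes Q :: "('a :: {field, finite}) fls ^ 'n ^ 'n"
  assumes "\<And>j. column j Q \<in> poly_vecs"
  shows "det Q \<in> range poly_to_fls"
proof -
  have "\<forall>i j. \<exists>p. Q $ i $ j = poly_to_fls p"
    using assms by (auto simp: poly_vecs_def column_def)
  then obtain P where "\<And>i j. Q $ i $ j = poly_to_fls (P i j)" by metis
  then have "Q = (\<chi> i j. poly_to_fls ((\<chi> i j. P i j) $ i $ j))" by (simp add: vec_eq_iff)
  also have "det \<dots> = poly_to_fls (det (\<chi> i j. P i j))"
    by (rule det_ring_hom[symmetric]) (simp_all add: poly_to_fls_add poly_to_fls_mult)
  finally show ?thesis by simp
qed

lemma one_le_fls_abs_poly:
  fixes f :: "'a :: {field, finite} fls"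
  assumes "f \<in> range poly_to_fls" "f \<noteq> 0"
  shows "1 \<le> fls_abs f"
proof -
  obtain p where p: "f = poly_to_fls p" "p \<noteq> 0" using assms by (metis imageE poly_to_fls_0)
  show ?thesis unfolding p(1) fls_abs_poly_to_fls[OF p(2)]
    using two_le_card_field[where 'a='a] by (intro one_le_power) linarith
qed

lemma matrix_with_columns_in_image:
  fixes g M :: "('a :: {field, finite}) fls ^ 'n ^ 'n"
  assumes "\<And>j. column j M \<in> (*v) g ` poly_vecs"
  obtains Q where "M = g ** Q" "\<And>j. column j Q \<in> poly_vecs"
proof -
  have "\<forall>j. \<exists>p\<in>poly_vecs. column j M = g *v p" using assms by blast
  then obtain p where p: "\<And>j. p j \<in> poly_vecs" "\<And>j. column j M = g *v p j" by metis
  define Q :: "'a fls ^ 'n ^ 'n" where "Q = (\<chi> i j. p j $ i)"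
  have col: "column j Q = p j" for j by (simp add: Q_def column_def vec_eq_iff)
  have "M = g ** Q"
    using p(2) by (simp add: vec_eq_iff column_def Q_def matrix_matrix_mult_def
        matrix_vector_mult_def)
  then show ?thesis using that p(1) col by metis
qed

lemma mult_poly_vecs_subset:
  fixes g M :: "('a :: {field, finite}) fls ^ 'n ^ 'n"
  assumes "\<And>j. column j M \<in> (*v) g ` poly_vecs"
  shows "(*v) M ` poly_vecs \<subseteq> (*v) g ` poly_vecs"
proof -
  obtain Q where Q: "M = g ** Q" "\<And>j. column j Q \<in> poly_vecs"
    using matrix_with_columns_in_image[OF assms] by blast
  have "Q *v p \<in> poly_vecs" if "p \<in> poly_vecs" for p
    using that Q(2) unfolding poly_vecs_def
    by (auto simp: matrix_vector_mult_def column_def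
        intro!: range_poly_to_fls_sum range_poly_to_fls_mult)
  then show ?thesis by (auto simp: Q(1) simp flip: matrix_vector_mul_assoc)
qed

text \<open>
  A smaller lattice has the larger covolume: the index is measured by the determinant of the
  polynomial matrix \<open>Q\<close> with \<open>g = M Q\<close>, and a nonzero polynomial has absolute value at least 1.
\<close>

lemma det_abs_le_of_lattice_subset:
  fixes g M :: "('a :: {field, finite}) fls ^ 'n ^ 'n"
  assumes "invertible g" "(*v) g ` poly_vecs \<subseteq> (*v) M ` poly_vecs"
  shows "fls_abs (det M) \<le> fls_abs (det g)"
proof -
  have "axis j 1 \<in> poly_vecs" for j :: 'n
    using fls_const_in_range[of 0] fls_const_in_range[of 1] by (auto simp: poly_vecs_def axis_def)
  then have "g *v axis j 1 \<in> (*v) M ` poly_vecs" for j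
    using assms(2) by blast
  then have "column j g \<in> (*v) M ` poly_vecs" for j
    by (simp add: matrix_vector_mult_def column_def axis_def if_distrib cong: if_cong)
  then obtain Q where Q: "g = M ** Q" "\<And>j. column j Q \<in> poly_vecs"
    using matrix_with_columns_in_image by blast
  have det: "det g = det M * det Q" by (simp add: Q(1) det_mul)
  have "1 \<le> fls_abs (det Q)"
    using assms(1) det by (intro one_le_fls_abs_poly det_polynomial_matrix Q(2))
      (auto simp: invertible_det_nz)
  then have "fls_abs (det M) * 1 \<le> fls_abs (det M) * fls_abs (det Q)"
    by (intro mult_left_mono) auto
  then show ?thesis by (simp add: det fls_abs_mult)
qed

section \<open>Lattices with a full set of shortest vectors\<close>

text \<open>
  The vector \<open>v\<close> has coordinates \<open>M\<^sup>-\<^sup>1 v\<close>; rounding them to polynomials leaves an error that \<open>M\<close> maps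
  into the ball of radius \<open>r/q\<close>.
\<close>

lemma rounding_along_matrix:
  fixes M :: "('a :: {field, finite}) fls ^ 'n ^ 'n"
  assumes "invertible M" "\<And>j. vec_norm (column j M) \<le> r"
  obtains p where "p \<in> poly_vecs" "vec_norm (v - M *v p) \<le> r / real CARD('a)"
proof -
  obtain M' where M': "M ** M' = mat 1" using assms(1) by (auto simp: invertible_def)
  obtain p where p: "p \<in> poly_vecs" "vec_norm (M' *v v - p) \<le> 1 / real CARD('a)"
    using poly_vecs_rounding by blast
  have "v - M *v p = M *v (M' *v v - p)"
    by (simp add: matrix_vector_mult_diff_distrib matrix_vector_mul_assoc M')
  then have "vec_norm (v - M *v p) \<le> r * (1 / real CARD('a))"
    using vec_norm_mult_le[OF assms(2) p(2)] by simp
  then show ?thesis using that p(1) by simp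
qed

text \<open>
  The rounding error of a lattice vector is again a lattice vector, and it is too short to be
  nonzero.  Over the integers this argument fails, since the errors of the coordinates add up; here
  the ultrametric inequality prevents this.
\<close>

lemma shortest_vectors_generate:
  fixes g M :: "('a :: {field, finite}) fls ^ 'n ^ 'n"
  assumes "invertible M" "0 < r" "\<And>j. vec_norm (column j M) \<le> r"
    and "\<And>j. column j M \<in> (*v) g ` poly_vecs"
    and short: "\<And>v. v \<in> (*v) g ` poly_vecs \<Longrightarrow> vec_norm v < r \<Longrightarrow> v = 0"
  shows "(*v) M ` poly_vecs = (*v) g ` poly_vecs"
proof
  show sub: "(*v) M ` poly_vecs \<subseteq> (*v) g ` poly_vecs"
    using assms(4) by (rule mult_poly_vecs_subset)
  have diff: "x - y \<in> poly_vecs" if x: "x \<in> poly_vecs" and y: "y \<in> poly_vecs"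
    for x y :: "'a fls ^ 'n"
  proof -
    have "\<forall>i. \<exists>p. (x - y) $ i = poly_to_fls p"
    proof
      fix i
      obtain p r where "x $ i = poly_to_fls p" "y $ i = poly_to_fls r"
        using x y unfolding poly_vecs_def by blast
      then have "(x - y) $ i = poly_to_fls (p - r)"
        using poly_to_fls_add[of "p - r" r] by simp
      then show "\<exists>p. (x - y) $ i = poly_to_fls p" ..
    qed
    then show ?thesis by (auto simp: poly_vecs_def)
  qed
  show "(*v) g ` poly_vecs \<subseteq> (*v) M ` poly_vecs"
  proof
    fix v assume v: "v \<in> (*v) g ` poly_vecs"
    obtain p where p: "p \<in> poly_vecs" "vec_norm (v - M *v p) \<le> r / real CARD('a)"
      using rounding_along_matrix[OF assms(1,3)] by blast
    have "v - M *v p \<in> (*v) g ` poly_vecs"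
    proof -
      obtain x y where "v = g *v x" "M *v p = g *v y" "x \<in> poly_vecs" "y \<in> poly_vecs"
        using v sub p(1) by blast
      then show ?thesis using diff[of x y]
        by (auto simp flip: matrix_vector_mult_diff_distrib)
    qed
    moreover have "r / real CARD('a) < r"
      using assms(2) two_le_card_field[where 'a='a] by (simp add: field_simps)
    ultimately have "v - M *v p = 0" using p(2) by (intro short) auto
    then show "v \<in> (*v) M ` poly_vecs" using p(1) by auto
  qed
qed

text \<open>
  The columns of \<open>M\<close>, scaled by \<open>x\<^sup>-\<^sup>k\<close>, have entries in the valuation ring.  Their reductions are
  linearly independent over the finite field: constants are polynomials, so a relation among the
  reductions would give a lattice vector of norm below \<open>q\<^sup>k\<close>.
\<close>

lemma det_abs_ge_of_shortest:
  fixes M :: "('a :: {field, finite}) fls ^ 'n ^ 'n"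
  assumes inv: "invertible M" and norm: "\<And>j. vec_norm (column j M) \<le> real CARD('a) powi k"
    and short: "\<And>v. v \<in> (*v) M ` poly_vecs \<Longrightarrow> vec_norm v < real CARD('a) powi k \<Longrightarrow> v = 0"
  shows "(real CARD('a) powi k) ^ CARD('n) \<le> fls_abs (det M)"
proof -
  let ?q = "real CARD('a)"
  have q: "2 \<le> ?q" by (rule two_le_card_field)
  define t :: "'a fls" where "t = fls_X_intpow k"
  have t: "fls_abs t = ?q powi (- k)" by (simp add: t_def fls_abs_def)
  define U where "U = (\<chi> i. t *s (M $ i))"
  have U_nth: "U $ i $ j $$ m = M $ i $ j $$ (m - k)" for i j m
    by (simp add: U_def t_def fls_X_intpow_times_conv_shift)
  have M_nth: "M $ i $ j $$ m = 0" if "m < - k" for i j m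
    using norm[of j] that by (auto simp: vec_norm_le_iff fls_abs_le_iff column_def)
  have detU: "det U = t ^ CARD('n) * det M"
    unfolding U_def using det_rows_mul[of "\<lambda>_. t" "\<lambda>i. M $ i"] by simp
  have "det U $$ 0 \<noteq> 0"
  proof
    assume "det U $$ 0 = 0"
    define U0 where "U0 = (\<chi> i j. U $ i $ j $$ 0)"
    have "det U0 = 0"
      using \<open>det U $$ 0 = 0\<close> det_fls_nth_0[of U] M_nth by (simp add: U0_def U_nth)
    then obtain c where c: "U0 *v c = 0" "c \<noteq> 0"
      using matrix_left_invertible_ker[of U0] invertible_det_nz[of U0] invertible_left_inverse[of U0]
      by blast
    define y :: "'a fls ^ 'n" where "y = (\<chi> j. fls_const (c $ j))"
    have "y \<in> poly_vecs" by (simp add: y_def poly_vecs_def fls_const_in_range)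
    have "fls_abs ((M *v y) $ i) \<le> ?q powi (k - 1)" for i
      unfolding fls_abs_le_iff
    proof (intro allI impI)
      fix m assume m: "m < - (k - 1)"
      have nth: "(M *v y) $ i $$ m = (\<Sum>j\<in>UNIV. M $ i $ j $$ m * c $ j)"
        by (simp add: matrix_vector_mult_def y_def fls_nth_sum)
      show "(M *v y) $ i $$ m = 0"
      proof (cases "m = - k")
        case True
        then have "(M *v y) $ i $$ m = (U0 *v c) $ i"
          unfolding nth by (simp add: matrix_vector_mult_def U0_def U_nth)
        then show ?thesis using c by simp
      qed (use m in \<open>simp add: nth M_nth\<close>)
    qed
    then have "vec_norm (M *v y) \<le> ?q powi (k - 1)" by (simp add: vec_norm_le_iff)
    also have "\<dots> < ?q powi k" using q by (intro power_int_strict_increasing) auto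
    finally have "M *v y = 0" using \<open>y \<in> poly_vecs\<close> by (intro short) auto
    then have "y = 0"
      using inv matrix_left_invertible_ker[of M] by (auto simp: invertible_left_inverse)
    then show False using c(2) by (auto simp: y_def vec_eq_iff)
  qed
  then have "fls_subdegree (det U) \<le> 0" "det U \<noteq> 0" by (auto intro: fls_subdegree_leI)
  then have "1 \<le> fls_abs (det U)"
    using q power_int_increasing[of 0 "- fls_subdegree (det U)" ?q] by (simp add: fls_abs_def)
  then show ?thesis
    using q by (simp add: detU fls_abs_mult fls_abs_power t power_int_minus field_simps)
qed

theorem theorem1p34:
  fixes L :: "(('a :: {field, finite}) fls ^ 'n) set"
  assumes "CARD('n) \<ge> 2"
    and "L \<in> well_rounded_lattices"
  shows "minkowski_fun L \<le> ereal (real CARD('a) powi (- int CARD('n)))"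
proof -
  let ?q = "real CARD('a)"
  let ?l = "min_length L"
  have q: "2 \<le> ?q" by (rule two_le_card_field)
  obtain g where g: "L = (*v) g ` poly_vecs" "invertible g" "fls_abs (det g) = 1"
    using assms(2) by (auto simp: well_rounded_lattices_def unimodular_lattices_def)
  obtain B where B: "B \<subseteq> L" "card B = CARD('n)" "vec.independent B" "\<And>v. v \<in> B \<Longrightarrow> vec_norm v = ?l"
    using assms(2) by (auto simp: well_rounded_lattices_def well_rounded_def)
  obtain M :: "'a fls ^ 'n ^ 'n" where M: "invertible M" "range (\<lambda>j. column j M) = B"
    by (rule invertible_matrix_of_independent[OF B(3,2)])
  have norm: "vec_norm (column j M) = ?l" for j using M(2) B(4) by blast
  have inL: "column j M \<in> (*v) g ` poly_vecs" for j using M(2) B(1) g(1) by blast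
  have "column undefined M \<noteq> 0" using B(3) M(2) vec.dependent_zero[of B] by auto
  then obtain k where k: "?l = ?q powi k" using vec_norm_eq_powi norm[of undefined] by metis
  have l_pos: "0 < ?l" unfolding k using q by simp
  have short: "v = 0" if "v \<in> L" "vec_norm v < ?l" for v
  proof (rule ccontr)
    assume "v \<noteq> 0"
    have "?l \<le> vec_norm v" unfolding min_length_def
      using that(1) \<open>v \<noteq> 0\<close> vec_norm_nonneg by (intro cINF_lower bdd_belowI2) auto
    with that(2) show False by simp
  qed
  have LM: "(*v) M ` poly_vecs = L"
    unfolding g(1)
  proof (rule shortest_vectors_generate[OF M(1) l_pos _ inL])
    show "vec_norm (column j M) \<le> ?l" for j by (simp add: norm)
    show "v = 0" if "v \<in> (*v) g ` poly_vecs" "vec_norm v < ?l" for v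
      using that short[of v] g(1) by simp
  qed
  have "?l ^ CARD('n) \<le> fls_abs (det M)"
    using det_abs_ge_of_shortest[OF M(1), of k, folded k] norm short LM by auto
  also have "\<dots> \<le> 1"
    using det_abs_le_of_lattice_subset[OF g(2), of M] LM g(1,3) by simp
  finally have l1: "?l ^ CARD('n) \<le> 1" .
  have "(INF u\<in>L. ereal (prod_norm (v - u))) \<le> ereal (?q powi (- int CARD('n)))" for v
  proof -
    obtain p where p: "p \<in> poly_vecs" "vec_norm (v - M *v p) \<le> ?l / ?q"
      by (rule rounding_along_matrix[OF M(1) eq_refl[OF norm]])
    have "prod_norm (v - M *v p) \<le> (?l / ?q) ^ CARD('n)" using p(2) by (rule prod_norm_le)
    also have "\<dots> \<le> 1 / ?q ^ CARD('n)"
      using l1 q by (simp add: power_divide divide_right_mono)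
    also have "\<dots> = ?q powi (- int CARD('n))" by (simp add: power_int_minus divide_inverse)
    finally have "ereal (prod_norm (v - M *v p)) \<le> ereal (?q powi (- int CARD('n)))" by simp
    then show ?thesis using p(1) LM by (intro INF_lower2[of "M *v p"]) auto
  qed
  then show ?thesis unfolding minkowski_fun_def by (rule SUP_least)
qed

end
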